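(* Consider the price-coupling game with consistent price conjectures $\bar{\mathcal{E}}_2$. Suppose the functions $g_i$, $i\in\mathcal{N}$, admit a potential function $\pi:X\to\mathbb{R}$. Consider the optimization problem $\mathbb{P}^2$: maximize $\sum_{i\in\mathcal{N}}h(p_i,x_i)+\pi(x)$ over $(x,p)\in\mathcal{F}^2$, where $p=(p_1,\dots,p_N)$. (1) If $(x^*,p^* )\in\mathcal{F}^2$ is a maximizer of $\mathbb{P}^2$, then $(x^*,p^* )$ is an equilibrium of $\bar{\mathcal{E}}_2$. (2) There exists an equilibrium of $\bar{\mathcal{E}}_2$ if the functions $(x,p)\mapsto\sum_{i\in\mathcal{N}}h(p_i,x_i)+\pi(x)$ and $f$ are continuous, the set $X$ is compact, and the set-valued function $\mathcal{M}$ is continuous and uniformly bounded.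
   Context: Setting: $\mathcal{N}=\{1,\dots,N\}$ is the set of players; $X_i\subseteq\mathbb{R}^{m_i}$ is the decision set of player $i$; $X=\prod_{i\in\mathcal{N}}X_i$; $x=(x_1,\dots,x_N)\in X$; $x^{-i}=(x_1,\dots,x_{i-1},x_{i+1},\dots,x_N)\in X^{-i}=\prod_{j\ne i}X_j$; one writes $x=(x_i,x^{-i})$. Prices lie in a Euclidean space $\mathbb{R}^k$; $p_i\in\mathbb{R}^k$ is the price conjectured by player $i$, $p=(p_1,\dots,p_N)$ and $p^{-i}=(p_j)_{j\neq i}$. $h$ is a real-valued function, common to all players, defined at $(p_i,x_i)$ for $p_i\in\mathbb{R}^k$, $x_i\in X_i$, $i\in\mathcal{N}$; $g_i:X\to\mathbb{R}$ is specific to player $i$. Price-determining player: for $x\in X$, $\mathcal{S}(x)$ is the problem of minimizing $f(x,q)$ over $q\in\mathcal{M}(x)$, where $f:X\times\mathbb{R}^k\to\mathbb{R}$ and $\mathcal{M}$ is a set-valued map assigning to each $x\in X$ a set $\mathcal{M}(x)\subseteq\mathbb{R}^k$. $\mathrm{SOL}[\mathcal{S}(x)]$ is the set of minimizers of $\mathcal{S}(x)$. Game $\bar{\mathcal{E}}_2$: given $(x^{-i},p^{-i})$, player $i$ maximizes $h(p_i,x_i)+g_i(x)$ over $(x_i,p_i)\in\bar\Omega_i(x^{-i},p^{-i})=\{(x_i,p_i) : x_i\in X_i,\ p_i\in\mathrm{SOL}[\mathcal{S}(x)],\ p_i=p_j\ \forall j\in\mathcal{N}\setminus\{i\}\}$,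 where $x=(x_i,x^{-i})$. Let $\mathcal{F}^2=\{(x,p_1,\dots,p_N) : x\in X,\ p_i\in\mathrm{SOL}[\mathcal{S}(x)]\ \forall i\in\mathcal{N},\ p_i=p_j\ \forall i,j\in\mathcal{N}\}$. A point $(x^*,p^* )\in\mathcal{F}^2$, $p^*=(p_1^*,\dots,p_N^* )$, is an equilibrium of $\bar{\mathcal{E}}_2$ if for all $i\in\mathcal{N}$, $h(p_i^*,x_i^* )+g_i(x^* )\ge h(p_i,x_i)+g_i(x_i,x^{-i*})$ for all $(x_i,p_i)\in\bar\Omega_i(x^{-i*},p^{-i*})$. The functions $g_i$, $i\in\mathcal{N}$, admit a potential function $\pi:X\to\mathbb{R}$ if for all $i\in\mathcal{N}$, all $x^{-i}\in X^{-i}$ and all $\tilde{x}_i,\hat{x}_i\in X_i$: $g_i(\tilde{x}_i,x^{-i})-g_i(\hat{x}_i,x^{-i})=\pi(\tilde{x}_i,x^{-i})-\pi(\hat{x}_i,x^{-i})$. Set-valued map conventions: $\mathcal{M}$ is continuous if it is open and closed at every $x\in X$; closed at $x$ means: $x_n\to x$ in $X$, $p_n\in\mathcal{M}(x_n)$, $p_n\to p$ imply $p\in\mathcal{M}(x)$; open at $x$ means: for $x_n\to x$ in $X$ and $p\in\mathcal{M}(x)$ there are an index $m$ and a sequence $p_n\to p$ with $p_n\in\mathcal{M}(x_n)$ for all $n\ge m$. $\mathcal{M}$ is uniformly bounded if $\bigcup_{x\in X}\mathcal{M}(x)$ is bounded.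
   Formalization: Part (2) additionally assumes that M(x) is nonempty for at least one x in X (so X is nonempty); otherwise F² is empty and no equilibrium can exist. *)

theory Defs
  imports "HOL-Analysis.Analysis"
begin

text \<open>
  The players are the elements of a finite type \<open>'n\<close>, and the prices are vectors in \<open>real ^ 'k\<close>.
  The dimensions \<open>m i\<close> may differ between the players, so the decision space of player \<open>i\<close> is
  \<^term>\<open>topspace (Euclidean_space (m i))\<close>, the sequences that vanish from index \<open>m i\<close> on; its topology
  is the one induced by the type \<open>nat \<Rightarrow> real\<close>, and profiles of decisions or prices carry the
  product topology of the function type.

  With this zero padding a vector may belong to several of the spaces. The common function \<open>h\<close>
  therefore takes the dimension as an extra argument: \<open>h q d v\<close> is its value at the price \<open>q\<close> and the
  vector \<open>v\<close> of dimension \<open>d\<close>. It does not depend on the player in any other way.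

  A profile \<open>x\<^sup>-\<^sup>i\<close> is represented by a full profile \<open>x\<close> whose \<open>i\<close>-th entry is irrelevant, and
  \<open>(y, x\<^sup>-\<^sup>i)\<close> by \<open>x(i := y)\<close>.
\<close>

type_synonym 'n decisions = "'n \<Rightarrow> nat \<Rightarrow> real"
type_synonym ('n, 'k) prices = "'n \<Rightarrow> real ^ 'k"

definition profiles :: "('n \<Rightarrow> (nat \<Rightarrow> real) set) \<Rightarrow> 'n decisions set" where
  "profiles X = {x. \<forall>i. x i \<in> X i}"

definition SOL ::
  "('n decisions \<Rightarrow> real ^ 'k \<Rightarrow> real) \<Rightarrow> ('n decisions \<Rightarrow> (real ^ 'k) set) \<Rightarrow> 'n decisions
    \<Rightarrow> (real ^ 'k) set" where
  "SOL f M x = {q \<in> M x. \<forall>r \<in> M x. f x q \<le> f x r}"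

definition Omega ::
  "('n \<Rightarrow> (nat \<Rightarrow> real) set) \<Rightarrow> ('n decisions \<Rightarrow> real ^ 'k \<Rightarrow> real)
    \<Rightarrow> ('n decisions \<Rightarrow> (real ^ 'k) set) \<Rightarrow> 'n \<Rightarrow> 'n decisions \<Rightarrow> ('n, 'k) prices
    \<Rightarrow> ((nat \<Rightarrow> real) \<times> (real ^ 'k)) set" where
  "Omega X f M i x p =
     {(y, q). y \<in> X i \<and> q \<in> SOL f M (x(i := y)) \<and> (\<forall>j. j \<noteq> i \<longrightarrow> q = p j)}"

definition F2 ::
  "('n \<Rightarrow> (nat \<Rightarrow> real) set) \<Rightarrow> ('n decisions \<Rightarrow> real ^ 'k \<Rightarrow> real)
    \<Rightarrow> ('n decisions \<Rightarrow> (real ^ 'k) set) \<Rightarrow> ('n decisions \<times> ('n, 'k) prices) set" where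
  "F2 X f M =
     {(x, p). x \<in> profiles X \<and> (\<forall>i. p i \<in> SOL f M x) \<and> (\<forall>i j. p i = p j)}"

definition equilibrium ::
  "('n \<Rightarrow> nat) \<Rightarrow> ('n \<Rightarrow> (nat \<Rightarrow> real) set) \<Rightarrow> (real ^ 'k \<Rightarrow> nat \<Rightarrow> (nat \<Rightarrow> real) \<Rightarrow> real)
    \<Rightarrow> ('n \<Rightarrow> 'n decisions \<Rightarrow> real) \<Rightarrow> ('n decisions \<Rightarrow> real ^ 'k \<Rightarrow> real)
    \<Rightarrow> ('n decisions \<Rightarrow> (real ^ 'k) set) \<Rightarrow> 'n decisions \<Rightarrow> ('n, 'k) prices \<Rightarrow> bool" where
  "equilibrium m X h g f M x p \<longleftrightarrow>
     (x, p) \<in> F2 X f M \<and>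
     (\<forall>i. \<forall>(y, q) \<in> Omega X f M i x p.
        h (p i) (m i) (x i) + g i x \<ge> h q (m i) y + g i (x(i := y)))"

definition admits_potential ::
  "('n \<Rightarrow> (nat \<Rightarrow> real) set) \<Rightarrow> ('n \<Rightarrow> 'n decisions \<Rightarrow> real) \<Rightarrow> ('n decisions \<Rightarrow> real) \<Rightarrow> bool" where
  "admits_potential X g \<pi> \<longleftrightarrow>
     (\<forall>i x. (\<forall>j. j \<noteq> i \<longrightarrow> x j \<in> X j) \<longrightarrow>
        (\<forall>y \<in> X i. \<forall>z \<in> X i.
           g i (x(i := y)) - g i (x(i := z)) = \<pi> (x(i := y)) - \<pi> (x(i := z))))"

definition P2_objective ::
  "('n::finite \<Rightarrow> nat) \<Rightarrow> (real ^ 'k \<Rightarrow> nat \<Rightarrow> (nat \<Rightarrow> real) \<Rightarrow> real) \<Rightarrow> ('n decisions \<Rightarrow> real)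
    \<Rightarrow> 'n decisions \<Rightarrow> ('n, 'k) prices \<Rightarrow> real" where
  "P2_objective m h \<pi> x p = (\<Sum>i\<in>UNIV. h (p i) (m i) (x i)) + \<pi> x"

definition P2_maximizer ::
  "('n::finite \<Rightarrow> nat) \<Rightarrow> ('n \<Rightarrow> (nat \<Rightarrow> real) set)
    \<Rightarrow> (real ^ 'k \<Rightarrow> nat \<Rightarrow> (nat \<Rightarrow> real) \<Rightarrow> real) \<Rightarrow> ('n decisions \<Rightarrow> real)
    \<Rightarrow> ('n decisions \<Rightarrow> real ^ 'k \<Rightarrow> real) \<Rightarrow> ('n decisions \<Rightarrow> (real ^ 'k) set)
    \<Rightarrow> 'n decisions \<Rightarrow> ('n, 'k) prices \<Rightarrow> bool" where
  "P2_maximizer m X h \<pi> f M x p \<longleftrightarrow>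
     (x, p) \<in> F2 X f M \<and>
     (\<forall>(y, q) \<in> F2 X f M. P2_objective m h \<pi> y q \<le> P2_objective m h \<pi> x p)"

definition svm_closed_at ::
  "'a::topological_space set \<Rightarrow> ('a \<Rightarrow> 'b::topological_space set) \<Rightarrow> 'a \<Rightarrow> bool" where
  "svm_closed_at S M x \<longleftrightarrow>
     (\<forall>\<xi> \<rho> q. (\<forall>n. \<xi> n \<in> S) \<and> \<xi> \<longlonglongrightarrow> x \<and> (\<forall>n. \<rho> n \<in> M (\<xi> n)) \<and> \<rho> \<longlonglongrightarrow> q \<longrightarrow> q \<in> M x)"

definition svm_open_at ::
  "'a::topological_space set \<Rightarrow> ('a \<Rightarrow> 'b::topological_space set) \<Rightarrow> 'a \<Rightarrow> bool" where
  "svm_open_at S M x \<longleftrightarrow>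
     (\<forall>\<xi> q. (\<forall>n. \<xi> n \<in> S) \<and> \<xi> \<longlonglongrightarrow> x \<and> q \<in> M x \<longrightarrow>
        (\<exists>l \<rho>. \<rho> \<longlonglongrightarrow> q \<and> (\<forall>n\<ge>l. \<rho> n \<in> M (\<xi> n))))"

definition svm_continuous_on ::
  "'a::topological_space set \<Rightarrow> ('a \<Rightarrow> 'b::topological_space set) \<Rightarrow> bool" where
  "svm_continuous_on S M \<longleftrightarrow> (\<forall>x \<in> S. svm_open_at S M x \<and> svm_closed_at S M x)"

definition svm_uniformly_bounded_on ::
  "'a set \<Rightarrow> ('a \<Rightarrow> 'b::metric_space set) \<Rightarrow> bool" where
  "svm_uniformly_bounded_on S M \<longleftrightarrow> bounded (\<Union>x\<in>S. M x)"

end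

theory Submission
  imports Defs
begin

text \<open>
  The consistency constraint \<open>p\<^sub>i = p\<^sub>j\<close> is shared: a deviation that is admissible for player \<open>i\<close> must
  conjecture the price of the other players, which therefore solves the pricing problem at the new
  profile for them as well. A unilateral deviation thus never leaves \<open>F2\<close>, and along it the
  objective of the optimization problem changes exactly as the payoff of player \<open>i\<close> does: the other
  terms \<open>h\<close> stay put, and \<open>\<pi>\<close> varies as \<open>g i\<close>. So a maximizer leaves no player a profitable
  deviation (\<open>deviation_in_F2\<close>, \<open>P2_objective_deviation\<close>).

  It remains to find a maximizer. Points of \<open>F2\<close> correspond to pairs of a profile and one common
  price, that is, to the graph of \<open>SOL\<close>. This graph is closed, as in Berge's maximum theorem: at a limit
  point, closedness of \<open>M\<close> gives feasibility, and openness of \<open>M\<close> lets every competing price be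
  approximated by prices feasible along the sequence, so that optimality survives the limit. Being
  bounded over a compact set of profiles, the graph is compact (\<open>compact_argmin_graph\<close>); it is
  nonempty by Weierstrass, applied to a nonempty \<open>M x\<close>; and the objective attains its maximum on it.
\<close>

section \<open>Maximizers are equilibria\<close>

lemma deviation_in_F2:
  assumes "(x, p) \<in> F2 X f M" and "(y, q) \<in> Omega X f M i x p"
  shows "(x(i := y), p(i := q)) \<in> F2 X f M"
proof -
  have "p(i := q) = (\<lambda>_. q)"
    using assms(2) by (auto simp: Omega_def)
  then show ?thesis
    using assms by (auto simp: F2_def Omega_def profiles_def)
qed

lemma P2_objective_deviation:
  fixes m :: "'n::finite \<Rightarrow> nat"
  assumes "admits_potential X g \<pi>" and "x \<in> profiles X" and "y \<in> X i"
  shows "P2_objective m h \<pi> (x(i := y)) (p(i := q)) - P2_objective m h \<pi> x p =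
    (h q (m i) y + g i (x(i := y))) - (h (p i) (m i) (x i) + g i x)"
proof -
  have "g i (x(i := y)) - g i (x(i := x i)) = \<pi> (x(i := y)) - \<pi> (x(i := x i))"
    using assms unfolding admits_potential_def profiles_def by blast
  moreover have "(\<Sum>j\<in>UNIV. h ((p(i := q)) j) (m j) ((x(i := y)) j)) =
      h q (m i) y + (\<Sum>j\<in>UNIV - {i}. h (p j) (m j) (x j))"
    by (simp add: sum.remove[of UNIV i])
  moreover have "(\<Sum>j\<in>UNIV. h (p j) (m j) (x j)) =
      h (p i) (m i) (x i) + (\<Sum>j\<in>UNIV - {i}. h (p j) (m j) (x j))"
    by (simp add: sum.remove[of UNIV i])
  ultimately show ?thesis
    by (simp add: P2_objective_def)
qed

lemma P2_maximizer_imp_equilibrium: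
  assumes pot: "admits_potential X g \<pi>" and max: "P2_maximizer m X h \<pi> f M x p"
  shows "equilibrium m X h g f M x p"
proof -
  have F: "(x, p) \<in> F2 X f M"
    using max by (simp add: P2_maximizer_def)
  have "h q (m i) y + g i (x(i := y)) \<le> h (p i) (m i) (x i) + g i x"
    if dev: "(y, q) \<in> Omega X f M i x p" for i y q
  proof -
    have "P2_objective m h \<pi> (x(i := y)) (p(i := q)) \<le> P2_objective m h \<pi> x p"
      using max deviation_in_F2[OF F dev] by (auto simp: P2_maximizer_def)
    moreover have "x \<in> profiles X" "y \<in> X i"
      using F dev by (auto simp: F2_def Omega_def)
    ultimately show ?thesis
      using P2_objective_deviation[OF pot, of x y i m h p q] by linarith
  qed
  then show ?thesis
    using F by (auto simp: equilibrium_def)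
qed

section \<open>Compactness of the solution graph\<close>

text \<open>
  The closed-graph half of Berge's maximum theorem. Openness of \<open>M\<close> is what carries optimality to
  the limit: without approximants feasible along the sequence, a price that appears only at the
  limit profile could undercut the limiting one.
\<close>

lemma closed_argmin_graph:
  fixes S :: "'a::metric_space set" and M :: "'a \<Rightarrow> 'b::metric_space set"
    and f :: "'a \<Rightarrow> 'b \<Rightarrow> real"
  assumes S: "closed S" and M: "svm_continuous_on S M"
    and f: "continuous_on (S \<times> UNIV) (\<lambda>(x, q). f x q)"
  shows "closed {(x, q). x \<in> S \<and> q \<in> M x \<and> (\<forall>r\<in>M x. f x q \<le> f x r)}"
  unfolding closed_sequential_limits
proof (intro allI impI, elim conjE)
  fix z l
  assume z: "\<forall>n. z n \<in> {(x, q). x \<in> S \<and> q \<in> M x \<and> (\<forall>r\<in>M x. f x q \<le> f x r)}"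
    and lim: "z \<longlonglongrightarrow> l"
  obtain x q where l: "l = (x, q)"
    by (cases l)
  define \<xi> where "\<xi> n = fst (z n)" for n
  define \<rho> where "\<rho> n = snd (z n)" for n
  have xlim: "\<xi> \<longlonglongrightarrow> x" and qlim: "\<rho> \<longlonglongrightarrow> q"
    using tendsto_fst[OF lim] tendsto_snd[OF lim] by (simp_all add: l \<xi>_def[abs_def] \<rho>_def[abs_def])
  have in_S: "\<xi> n \<in> S" and in_M: "\<rho> n \<in> M (\<xi> n)"
    and opt: "\<And>r. r \<in> M (\<xi> n) \<Longrightarrow> f (\<xi> n) (\<rho> n) \<le> f (\<xi> n) r" for n
    using z[rule_format, of n] by (auto simp: \<xi>_def \<rho>_def case_prod_beta)
  have x: "x \<in> S"
    using S in_S xlim by (meson closed_sequentially)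
  have flim: "(\<lambda>n. f (\<xi> n) (\<sigma> n)) \<longlonglongrightarrow> f x r" if "\<sigma> \<longlonglongrightarrow> r" for \<sigma> r
    using continuous_on_tendsto_compose[OF f tendsto_Pair[OF xlim that]] x in_S by simp
  have "q \<in> M x"
    using M x in_S xlim in_M qlim unfolding svm_continuous_on_def svm_closed_at_def by blast
  moreover have "f x q \<le> f x r" if r: "r \<in> M x" for r
  proof -
    obtain k \<sigma> where \<sigma>: "\<sigma> \<longlonglongrightarrow> r" "\<forall>n\<ge>k. \<sigma> n \<in> M (\<xi> n)"
      using M x in_S xlim r unfolding svm_continuous_on_def svm_open_at_def by blast
    show ?thesis
      using LIMSEQ_le[OF flim[OF qlim] flim[OF \<sigma>(1)]] \<sigma>(2) opt by blast
  qed
  ultimately show "l \<in> {(x, q). x \<in> S \<and> q \<in> M x \<and> (\<forall>r\<in>M x. f x q \<le> f x r)}"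
    using x l by simp
qed

lemma compact_argmin_graph:
  fixes S :: "'a::metric_space set" and M :: "'a \<Rightarrow> 'b::heine_borel set"
    and f :: "'a \<Rightarrow> 'b \<Rightarrow> real"
  assumes S: "compact S" and M: "svm_continuous_on S M" and bdd: "svm_uniformly_bounded_on S M"
    and f: "continuous_on (S \<times> UNIV) (\<lambda>(x, q). f x q)"
  shows "compact {(x, q). x \<in> S \<and> q \<in> M x \<and> (\<forall>r\<in>M x. f x q \<le> f x r)}" (is "compact ?G")
proof -
  have "compact (S \<times> closure (\<Union>x\<in>S. M x))"
    using S bdd by (intro compact_Times) (auto simp: svm_uniformly_bounded_on_def compact_closure)
  moreover have "?G \<subseteq> S \<times> closure (\<Union>x\<in>S. M x)"
    using closure_subset[of "\<Union>x\<in>S. M x"] by auto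
  moreover have "closed ?G"
    using closed_argmin_graph[OF compact_imp_closed[OF S] M f] .
  ultimately show ?thesis
    using compact_Int_closed[of "S \<times> closure (\<Union>x\<in>S. M x)" ?G] by (simp add: inf.absorb2)
qed

lemma argmin_nonempty:
  fixes M :: "'a::topological_space \<Rightarrow> 'b::heine_borel set" and f :: "'a \<Rightarrow> 'b \<Rightarrow> real"
  assumes x: "x \<in> S" and ne: "M x \<noteq> {}"
    and M: "svm_continuous_on S M" and bdd: "svm_uniformly_bounded_on S M"
    and f: "continuous_on (S \<times> UNIV) (\<lambda>(x, q). f x q)"
  shows "\<exists>q\<in>M x. \<forall>r\<in>M x. f x q \<le> f x r"
proof -
  have "q \<in> M x" if "\<forall>n. \<rho> n \<in> M x" "\<rho> \<longlonglongrightarrow> q" for \<rho> q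
  proof -
    have "svm_closed_at S M x"
      using M x by (simp add: svm_continuous_on_def)
    from this[unfolded svm_closed_at_def, rule_format, of "\<lambda>_. x" \<rho> q]
    show ?thesis
      using x that by simp
  qed
  then have "closed (M x)"
    unfolding closed_sequential_limits by blast
  moreover have "bounded (M x)"
    using bdd x unfolding svm_uniformly_bounded_on_def by (meson UN_upper bounded_subset)
  ultimately have "compact (M x)"
    by (simp add: compact_eq_bounded_closed)
  moreover have "continuous_on (M x) (\<lambda>q. (\<lambda>(x, q). f x q) (x, q))"
    using x by (intro continuous_on_compose2[OF f] continuous_on_Pair continuous_on_const
        continuous_on_id) auto
  ultimately show ?thesis
    using continuous_attains_inf[of "M x" "f x"] ne by simp
qed

section \<open>Existence of a maximizer\<close>

lemma P2_maximizer_exists: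
  fixes m :: "'n::finite \<Rightarrow> nat" and f :: "'n decisions \<Rightarrow> real ^ 'k \<Rightarrow> real"
  assumes obj: "continuous_on (profiles X \<times> UNIV) (\<lambda>(x, p). P2_objective m h \<pi> x p)"
    and f: "continuous_on (profiles X \<times> UNIV) (\<lambda>(x, q). f x q)"
    and X: "compact (profiles X)"
    and M: "svm_continuous_on (profiles X) M"
    and bdd: "svm_uniformly_bounded_on (profiles X) M"
    and ne: "\<exists>x\<in>profiles X. M x \<noteq> {}"
  shows "\<exists>x p. P2_maximizer m X h \<pi> f M x p"
proof -
  let ?G = "{(x, q). x \<in> profiles X \<and> q \<in> M x \<and> (\<forall>r\<in>M x. f x q \<le> f x r)}"
  let ?\<phi> = "\<lambda>z :: 'n decisions \<times> (real ^ 'k). P2_objective m h \<pi> (fst z) (\<lambda>_. snd z)"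
  have graph: "(x, q) \<in> ?G \<longleftrightarrow> (x, \<lambda>_. q) \<in> F2 X f M" for x q
    by (auto simp: F2_def SOL_def)
  have "continuous_on ?G (\<lambda>z. (fst z, \<lambda>_ :: 'n. snd z))"
    by (intro continuous_on_Pair continuous_on_fst continuous_on_id
        continuous_on_coordinatewise_then_product[OF continuous_on_snd])
  then have "continuous_on ?G (\<lambda>z. (\<lambda>(x, p). P2_objective m h \<pi> x p) (fst z, \<lambda>_. snd z))"
    by (rule continuous_on_compose2[OF obj]) auto
  then have "continuous_on ?G ?\<phi>"
    by simp
  moreover have "compact ?G"
    by (rule compact_argmin_graph[OF X M bdd f])
  moreover have "?G \<noteq> {}"
  proof -
    obtain x where x: "x \<in> profiles X" "M x \<noteq> {}"
      using ne by blast
    then show ?thesis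
      using argmin_nonempty[OF x M bdd f] by blast
  qed
  ultimately obtain z where z: "z \<in> ?G" "\<forall>w\<in>?G. ?\<phi> w \<le> ?\<phi> z"
    using continuous_attains_sup[of ?G ?\<phi>] by blast
  obtain x q where xq: "z = (x, q)"
    by (cases z)
  have "P2_objective m h \<pi> y p \<le> P2_objective m h \<pi> x (\<lambda>_. q)" if "(y, p) \<in> F2 X f M" for y p
  proof -
    have "p i = p j" for i j
      using that by (auto simp: F2_def)
    then obtain r where "p = (\<lambda>_. r)"
      by (metis ext)
    then show ?thesis
      using bspec[OF z(2), of "(y, r)"] graph[of y r] that xq by simp
  qed
  then have "P2_maximizer m X h \<pi> f M x (\<lambda>_. q)"
    using z(1) graph[of x q] xq by (auto simp: P2_maximizer_def)
  then show ?thesis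
    by blast
qed

theorem mainTheorem3:
  fixes m :: "'n::finite \<Rightarrow> nat"
    and X :: "'n \<Rightarrow> (nat \<Rightarrow> real) set"
    and h :: "real ^ 'k \<Rightarrow> nat \<Rightarrow> (nat \<Rightarrow> real) \<Rightarrow> real"
    and g :: "'n \<Rightarrow> ('n \<Rightarrow> nat \<Rightarrow> real) \<Rightarrow> real"
    and \<pi> :: "('n \<Rightarrow> nat \<Rightarrow> real) \<Rightarrow> real"
    and f :: "('n \<Rightarrow> nat \<Rightarrow> real) \<Rightarrow> real ^ 'k \<Rightarrow> real"
    and M :: "('n \<Rightarrow> nat \<Rightarrow> real) \<Rightarrow> (real ^ 'k) set"
  assumes "\<forall>i. X i \<subseteq> topspace (Euclidean_space (m i))"
    and "admits_potential X g \<pi>"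
  shows "(\<forall>x p. P2_maximizer m X h \<pi> f M x p \<longrightarrow> equilibrium m X h g f M x p) \<and>
    (continuous_on (profiles X \<times> UNIV) (\<lambda>(x, p). P2_objective m h \<pi> x p) \<and>
     continuous_on (profiles X \<times> UNIV) (\<lambda>(x, q). f x q) \<and>
     compact (profiles X) \<and>
     svm_continuous_on (profiles X) M \<and>
     svm_uniformly_bounded_on (profiles X) M \<and>
     (\<exists>x \<in> profiles X. M x \<noteq> {})
     \<longrightarrow> (\<exists>x p. equilibrium m X h g f M x p))"
proof (intro conjI allI impI, goal_cases)
  case (1 x p)
  then show ?case
    by (rule P2_maximizer_imp_equilibrium[OF assms(2)])
next
  case 2
  then obtain x p where "P2_maximizer m X h \<pi> f M x p"
    using P2_maximizer_exists[of X m h \<pi> f M] by auto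
  then show ?case
    using P2_maximizer_imp_equilibrium[OF assms(2)] by blast
qed

end
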